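(* Let $\mathbf{X}=(\mathbf{X}_n)_{n\in\mathbb{N}}$ be the iterate process generated by the recursive adaptive stochastic Frank–Wolfe algorithm (defined in the context) with starting random variable $\mathbf{X}_0$, domain approximation process $\mathbf{D}$ and objective approximation process $\mathbf{F}$. Let $\varepsilon,\beta_1,\beta_2\in[0,1]$, $r_1,r_2\in(0,1]$, $\eta_1,\eta_2\ge0$ and $c_1,c_2>0$ be such that (i) $E\in\mathscr{D}$ satisfies $D\subseteq E\subseteq\operatorname{dom}(f)$ and $\mathbb{P}\big[\bigcup_{n\in\mathbb{N}}\mathbf{D}_n\subseteq E\big]\ge1-\varepsilon$; (ii) $\mathbb{P}\big[d_H(\mathbf{D}_{n+1},D)\le c_1\lambda_n^{r_1}+\eta_1\text{ for all }n\in\mathbb{N}\big]\ge1-\beta_1$; (iii) $\mathbb{P}\big[\sup_{x\in E}\lVert\nabla\mathbf{F}_{n+1}(x)-\nabla f(x)\rVert\le c_2\lambda_n^{r_2}+\eta_2\text{ for all }n\in\mathbb{N}\big]\ge1-\beta_2$. Assume that the uniform curvature constant $$C=\sup\Big\{\tfrac{2}{\lambda^2}\big(f(x+\lambda(s-x))-f(x)-\lambda\langle s-x\mid\nabla f(x)\rangle\big): x,s\in E,\ \lambda\in(0,1]\Big\}$$ is finite. Let $\Delta=\operatorname{diam}(E)$ and $L=\max\{\lVert\nabla f(x)\rVert:x\in E\}$. Then there exist constants $A,B\ge0$ such that, with $r=\min\{r_1,r_2\}$, $$\mathbb{P}\Big[-A\lambda_n^{r_1}-\eta_1L\le f(\mathbf{X}_n)-P^\star\le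 B\lambda_n^{r}+\eta_1L+2\eta_2\Delta\ \text{ for all }n\in\mathbb{N}\Big]\ge1-(\beta_1+\beta_2+\varepsilon).$$
   Context: $\mathbb{N}=\{1,2,\dots\}$, $\mathbb{N}_0=\mathbb{N}\cup\{0\}$. $H$ is a finite-dimensional real Hilbert space with inner product $\langle\cdot\mid\cdot\rangle$ and induced norm $\lVert\cdot\rVert$. $f:\operatorname{dom}(f)\to\mathbb{R}$ is convex and continuously differentiable, with $\operatorname{dom}(f)\subseteq H$ closed; $D\subseteq\operatorname{dom}(f)$ is nonempty, compact and convex; $P^\star=\min_{x\in D}f(x)$. $(\Omega,\Sigma,\mathbb{P})$ is a complete probability space. $\lambda_n=2/(n+2)$ for $n\in\mathbb{N}_0$. $\mathscr{D}$ is the set of nonempty compact convex subsets of $H$ with the Hausdorff metric $d_H(X,Y)=\max\{\sup_{x\in X}\inf_{y\in Y}\lVert x-y\rVert,\ \sup_{y\in Y}\inf_{x\in X}\lVert x-y\rVert\}$ and its Borel $\sigma$-algebra. A domain approximation process is a stochastic process $\mathbf{D}:\mathbb{N}\times\Omega\to\mathscr{D}$, i.e. each $\mathbf{D}_n:\Omega\to\mathscr{D}$ is measurable. Given $E\in\mathscr{D}$ with $D\subseteq E\subseteq\operatorname{dom}(f)$ (the uniform extension domain), $\mathscr{F}=\{g\in C^1(E,\mathbb{R}): g\text{ convex}\}$ carries the norm $\lVert g\rVert_\infty=\sup_{x\in E}|g(x)|+\sup_{x\in E}\lVert\nabla g(x)\rVert$ and the corresponding Borel $\sigma$-algebra. An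 objective approximation process is a stochastic process $\mathbf{F}:\mathbb{N}\times\Omega\to\mathscr{F}$, i.e. each $\mathbf{F}_n:\Omega\to\mathscr{F}$ is measurable. Algorithm: $\mathbf{X}_0:\Omega\to H$ is measurable with $\mathbf{X}_0\in E$ almost surely. Put $N=\{\bigcup_{n\in\mathbb{N}}\mathbf{D}_n\subseteq E\}\cap\{\mathbf{X}_0\in E\}\in\Sigma$. For $n\in\mathbb{N}_0$, $\mathbf{S}_{n+1}:\Omega\to H$ is a measurable selection with $$\mathbf{S}_{n+1}(\omega)\in\operatorname{arg\,min}\{\mathbf{1}_N(\omega)\langle s\mid\nabla\mathbf{F}_{n+1}(\omega)(\mathbf{X}_n(\omega))\rangle: s\in\mathbf{D}_{n+1}(\omega)\}\quad\text{for all }\omega\in\Omega$$ (the objective is read as $0$ for $\omega\notin N$), and $\mathbf{X}_{n+1}=\mathbf{X}_n+\lambda_n(\mathbf{S}_{n+1}-\mathbf{X}_n)$. On $N$ all $\mathbf{X}_n$ lie in $E$. *)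

theory Defs
  imports "HOL-Probability.Probability"
begin

text \<open>The Borel \<open>\<sigma>\<close>-algebra of the metric \<open>d\<close> on the carrier \<open>X\<close>.  The open sets are written out,
  rather than taken from \<^locale>\<open>Metric_space\<close>, because that locale also requires \<open>d\<close> to be
  symmetric and nonnegative off \<open>X\<close>; for a metric space the two agree (see below).\<close>

definition metric_borel :: "'b set \<Rightarrow> ('b \<Rightarrow> 'b \<Rightarrow> real) \<Rightarrow> 'b measure" where
  "metric_borel X d = sigma X {U. U \<subseteq> X \<and> (\<forall>x\<in>U. \<exists>e>0. \<forall>y\<in>X. d x y < e \<longrightarrow> y \<in> U)}"

lemma metric_borel_eq_mtopology:
  assumes "Metric_space X d"
  shows "metric_borel X d = sigma X {U. openin (Metric_space.mtopology X d) U}"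
proof -
  interpret Metric_space X d by fact
  have "openin mtopology U \<longleftrightarrow> U \<subseteq> X \<and> (\<forall>x\<in>U. \<exists>e>0. \<forall>y\<in>X. d x y < e \<longrightarrow> y \<in> U)" for U
  proof -
    have "mball x e \<subseteq> U \<longleftrightarrow> (\<forall>y\<in>X. d x y < e \<longrightarrow> y \<in> U)" if "x \<in> X" for x e
      using that by auto
    then show ?thesis
      unfolding openin_mtopology by blast
  qed
  then show ?thesis
    by (simp add: metric_borel_def)
qed

lemma space_metric_borel [simp]: "space (metric_borel X d) = X"
  unfolding metric_borel_def by (rule space_measure_of) auto

definition compact_convex_sets :: "'a::euclidean_space set set" where
  "compact_convex_sets = {K. K \<noteq> {} \<and> compact K \<and> convex K}"

definition hausdorff_dist :: "'a::real_normed_vector set \<Rightarrow> 'a set \<Rightarrow> real" where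
  "hausdorff_dist X Y =
     max (SUP x\<in>X. INF y\<in>Y. norm (x - y)) (SUP y\<in>Y. INF x\<in>X. norm (x - y))"

abbreviation hausdorff_borel :: "'a::euclidean_space set measure" where
  "hausdorff_borel \<equiv> metric_borel compact_convex_sets hausdorff_dist"

text \<open>\<open>g\<close> is continuously differentiable on \<open>S\<close> with gradient field \<open>g'\<close>.  The set \<open>S\<close> is typically
  closed, so derivatives are taken within \<open>S\<close>.  On a convex set with nonempty interior the field
  is determined by \<open>g\<close>; on a lower-dimensional set its component normal to the affine hull
  is not.\<close>

definition has_C1_gradient_on ::
    "('a::real_inner \<Rightarrow> real) \<Rightarrow> ('a \<Rightarrow> 'a) \<Rightarrow> 'a set \<Rightarrow> bool" where
  "has_C1_gradient_on g g' S \<longleftrightarrow>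
     (\<forall>x\<in>S. (g has_derivative (\<lambda>h. h \<bullet> g' x)) (at x within S)) \<and> continuous_on S g'"

lemma has_C1_gradient_on_unique:
  fixes g :: "'a::euclidean_space \<Rightarrow> real"
  assumes S: "convex S" "interior S \<noteq> {}"
    and g1: "has_C1_gradient_on g g1 S" and g2: "has_C1_gradient_on g g2 S"
    and x: "x \<in> S"
  shows "g1 x = g2 x"
proof -
  define w where "w = g1 x - g2 x"
  have der: "((\<lambda>_. 0::real) has_derivative (\<lambda>h. h \<bullet> w)) (at x within S)"
  proof -
    have "((\<lambda>y. g y - g y) has_derivative (\<lambda>h. h \<bullet> g1 x - h \<bullet> g2 x)) (at x within S)"
      using g1 g2 x unfolding has_C1_gradient_on_def by (intro has_derivative_diff) auto
    then show ?thesis by (simp add: w_def inner_diff_right)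
  qed
  have orth: "(y - x) \<bullet> w = 0" if y: "y \<in> S" for y
  proof -
    define p where "p = (\<lambda>t::real. x + t *\<^sub>R (y - x))"
    have pS: "p ` {0..1} \<subseteq> S"
    proof
      fix z assume "z \<in> p ` {0..1}"
      then obtain t where t: "t \<in> {0..1}" "z = p t" by auto
      have "p t = (1 - t) *\<^sub>R x + t *\<^sub>R y" by (simp add: p_def algebra_simps)
      then show "z \<in> S" using S(1) x y t by (auto intro!: convexD)
    qed
    have dp: "(p has_derivative (\<lambda>t. t *\<^sub>R (y - x))) (at 0 within {0..1})"
      unfolding p_def by (auto intro!: derivative_eq_intros)
    have "((\<lambda>_. 0::real) has_derivative (\<lambda>h. h \<bullet> w)) (at (p 0) within p ` {0..1})"
      using has_derivative_subset[OF der pS] by (simp add: p_def)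
    from diff_chain_within[OF dp this]
    have "((\<lambda>_. 0::real) has_vector_derivative ((y - x) \<bullet> w)) (at 0 within {0..1})"
      by (simp add: has_vector_derivative_def o_def)
    moreover have "((\<lambda>_. 0::real) has_vector_derivative 0) (at 0 within {0..1})"
      by (rule has_vector_derivative_const)
    ultimately show ?thesis
      by (intro vector_derivative_unique_within_closed_interval[of 0 1 0]) auto
  qed
  obtain a e where e: "e > 0" and ball: "ball a e \<subseteq> S"
    using S(2) by (meson ex_in_conv mem_interior)
  define b where "b = a + (e / (2 * (norm w + 1))) *\<^sub>R w"
  have "e * norm w < e * (2 * (norm w + 1))"
    using e by (intro mult_strict_left_mono) (auto simp: add_strict_increasing2)
  moreover have nw: "0 < 2 * (norm w + 1)"
    by (simp add: add_nonneg_pos)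
  ultimately have "dist a b < e"
    using e by (simp add: b_def dist_norm pos_divide_less_eq)
  then have "a \<in> S" "b \<in> S"
    using ball e by auto
  then have "(b - x) \<bullet> w - (a - x) \<bullet> w = 0"
    by (simp add: orth)
  then have "(e / (2 * (norm w + 1))) * (w \<bullet> w) = 0"
    by (simp add: b_def inner_add_left inner_diff_left)
  then show ?thesis
    using e nw by (simp add: w_def)
qed

text \<open>Convex functions in \<open>C\<^sup>1(E, \<real>)\<close>, each carried together with its gradient field, so that
  the norm below makes sense for every \<open>E\<close>, including lower-dimensional ones.  Extensionality
  makes the elements functions on \<open>E\<close>.\<close>

definition convex_C1 :: "'a::euclidean_space set \<Rightarrow> (('a \<Rightarrow> real) \<times> ('a \<Rightarrow> 'a)) set" where
  "convex_C1 E = {(g, g'). g \<in> extensional E \<and> g' \<in> extensional E \<and>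
                           convex_on E g \<and> has_C1_gradient_on g g' E}"

definition C1_dist ::
    "'a::euclidean_space set \<Rightarrow> ('a \<Rightarrow> real) \<times> ('a \<Rightarrow> 'a) \<Rightarrow> ('a \<Rightarrow> real) \<times> ('a \<Rightarrow> 'a) \<Rightarrow> real" where
  "C1_dist E = (\<lambda>(g, g') (h, h').
     (SUP x\<in>E. \<bar>g x - h x\<bar>) + (SUP x\<in>E. norm (g' x - h' x)))"

abbreviation C1_borel :: "'a::euclidean_space set \<Rightarrow> (('a \<Rightarrow> real) \<times> ('a \<Rightarrow> 'a)) measure" where
  "C1_borel E \<equiv> metric_borel (convex_C1 E) (C1_dist E)"

definition fw_step :: "nat \<Rightarrow> real" where
  "fw_step n = 2 / (real n + 2)"

definition fw_good_event ::
    "'w measure \<Rightarrow> 'a::euclidean_space set \<Rightarrow> (nat \<Rightarrow> 'w \<Rightarrow> 'a set) \<Rightarrow> ('w \<Rightarrow> 'a) \<Rightarrow> 'w set" where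
  "fw_good_event M E D X0 = {\<omega> \<in> space M. (\<Union>n\<in>{1..}. D n \<omega>) \<subseteq> E \<and> X0 \<omega> \<in> E}"

text \<open>\<open>X\<close> is an iterate process of the adaptive stochastic Frank--Wolfe algorithm with selections
  \<open>S\<close>.  The processes \<open>D\<close>, \<open>F'\<close> and \<open>S\<close> are only used at indices \<open>n \<ge> 1\<close>.  Off the good event the
  factor \<open>indicator\<close> makes the objective \<open>0\<close>, whatever the value of \<open>F'\<close>.\<close>

definition frank_wolfe_process ::
    "'w measure \<Rightarrow> 'a::euclidean_space set \<Rightarrow> (nat \<Rightarrow> 'w \<Rightarrow> 'a set) \<Rightarrow> (nat \<Rightarrow> 'w \<Rightarrow> 'a \<Rightarrow> 'a) \<Rightarrow>
     (nat \<Rightarrow> 'w \<Rightarrow> 'a) \<Rightarrow> (nat \<Rightarrow> 'w \<Rightarrow> 'a) \<Rightarrow> bool" where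
  "frank_wolfe_process M E D F' S X \<longleftrightarrow>
     X 0 \<in> borel_measurable M \<and> (AE \<omega> in M. X 0 \<omega> \<in> E) \<and>
     (\<forall>n. S (Suc n) \<in> borel_measurable M \<and>
        (\<forall>\<omega>\<in>space M.
           is_arg_min
             (\<lambda>s. indicator (fw_good_event M E D (X 0)) \<omega> * (s \<bullet> F' (Suc n) \<omega> (X n \<omega>)))
             (\<lambda>s. s \<in> D (Suc n) \<omega>) (S (Suc n) \<omega>) \<and>
           X (Suc n) \<omega> = X n \<omega> + fw_step n *\<^sub>R (S (Suc n) \<omega> - X n \<omega>)))"

definition curvature_constant ::
    "('a::euclidean_space \<Rightarrow> real) \<Rightarrow> ('a \<Rightarrow> 'a) \<Rightarrow> 'a set \<Rightarrow> ereal" where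
  "curvature_constant f f' E =
     (SUP (x, s, l) \<in> E \<times> E \<times> {0<..1}.
        ereal (2 / l\<^sup>2 * (f (x + l *\<^sub>R (s - x)) - f x - l * ((s - x) \<bullet> f' x))))"

end

theory Submission
  imports Defs
begin

text \<open>Let \<open>e\<^sub>n\<close> be either \<open>f X\<^sub>n - P\<^sup>\<star>\<close> or the distance of \<open>X\<^sub>n\<close> to the domain.  Comparing the selection
  \<open>S\<^sub>n\<^sub>+\<^sub>1\<close> with a point of \<open>D\<^sub>n\<^sub>+\<^sub>1\<close> close to a minimiser, respectively using that the
  distance to a convex set is convex, yields in both cases a recursion
  \<open>e\<^sub>n\<^sub>+\<^sub>1 \<le> (1 - \<lambda>\<^sub>n) e\<^sub>n + \<lambda>\<^sub>n (Q \<lambda>\<^sub>n\<^sup>\<rho> + K)\<close>, hence \<open>e\<^sub>n \<le> B \<lambda>\<^sub>n\<^sup>\<rho> + K\<close>.  The first instance is the upper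
  bound; the second gives the lower bound through the gradient inequality at the projection of
  \<open>X\<^sub>n\<close> to the domain.  The error bounds are assumed from \<open>n = 1\<close> on, so the
  recursion starts at \<open>X\<^sub>1\<close>, of which only \<open>X\<^sub>1 \<in> E\<close> is used.\<close>

section \<open>Step sizes and the error recursion\<close>

lemma fw_step_pos [simp]: "0 < fw_step n"
  by (simp add: fw_step_def)

lemma fw_step_nonneg [simp]: "0 \<le> fw_step n"
  by (simp add: fw_step_def)

lemma fw_step_le_1 [simp]: "fw_step n \<le> 1"
  by (simp add: fw_step_def)

text \<open>The ratio \<open>q\<close> of consecutive steps is (n+2)/(n+3), which is at least
  (n+1)/(n+2), that is \<open>1 - fw_step n / 2\<close>. As \<open>q\<close> and
  \<open>\<rho>\<close> are at most 1, raising \<open>q\<close> to the power \<open>\<rho>\<close>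
  only increases it.\<close>

lemma fw_step_powr_Suc_ge:
  assumes "\<rho> \<in> {0<..1}"
  shows "(1 - fw_step n / 2) * fw_step n powr \<rho> \<le> fw_step (Suc n) powr \<rho>"
proof -
  define q where "q = fw_step (Suc n) / fw_step n"
  have q: "0 < q" "q \<le> 1" "1 - fw_step n / 2 \<le> q"
    by (auto simp: q_def fw_step_def field_simps)
  have "q powr 1 \<le> q powr \<rho>"
    using assms q by (intro powr_mono') auto
  with q have "(1 - fw_step n / 2) * fw_step n powr \<rho> \<le> q powr \<rho> * fw_step n powr \<rho>"
    by (intro mult_right_mono) auto
  also have "\<dots> = (q * fw_step n) powr \<rho>"
    using q by (simp add: powr_mult)
  also have "q * fw_step n = fw_step (Suc n)"
    by (simp add: q_def less_imp_neq[OF fw_step_pos, symmetric])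
  finally show ?thesis .
qed

text \<open>With l the step size, the contraction by l is split into two halves. One absorbs the
  perturbation, because \<open>Q \<le> B / 2\<close>; the other pays for the decay of the rate from
  n to n+1, by \<open>fw_step_powr_Suc_ge\<close>. The averaging reproduces the constant
  \<open>K\<close> without amplifying it.\<close>

lemma fw_step_recursion_bound:
  fixes a :: "nat \<Rightarrow> real"
  assumes \<rho>: "\<rho> \<in> {0<..1}" and B: "0 \<le> B" "2 * Q \<le> B"
    and init: "a 1 \<le> 2 / 3 * B + K"
    and step: "\<And>n. n \<ge> 1 \<Longrightarrow>
      a (Suc n) \<le> (1 - fw_step n) * a n + fw_step n * (Q * fw_step n powr \<rho> + K)"
    and "n \<ge> 1"
  shows "a n \<le> B * fw_step n powr \<rho> + K"
  using \<open>n \<ge> 1\<close>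
proof (induction n rule: dec_induct)
  case base
  \<comment> \<open>Here 2/3 is \<open>fw_step 1\<close>; since \<open>\<rho> \<le> 1\<close>, the
    initial condition can be stated without \<open>\<rho>\<close>.\<close>
  have "(2/3::real) powr 1 \<le> (2/3) powr \<rho>"
    using \<rho> by (intro powr_mono') auto
  then have "2 / 3 * B \<le> B * (2/3) powr \<rho>"
    using mult_left_mono[OF _ B(1), of "2 / 3" "(2 / 3) powr \<rho>"] by (simp add: mult.commute)
  then show ?case
    using init by (simp add: fw_step_def)
next
  case (step n)
  let ?l = "fw_step n" and ?p = "fw_step n powr \<rho>"
  have "a (Suc n) \<le> (1 - ?l) * a n + ?l * (Q * ?p + K)"
    using assms(5) step.hyps by simp
  also have "\<dots> \<le> (1 - ?l) * (B * ?p + K) + ?l * (Q * ?p + K)"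
    using step.IH by (intro add_right_mono mult_left_mono) auto
  also have "\<dots> = (1 - ?l) * B * ?p + ?l * Q * ?p + K"
    by (simp add: algebra_simps)
  also have "\<dots> \<le> (1 - ?l) * B * ?p + ?l * (B / 2) * ?p + K"
    using B by (intro add_mono mult_right_mono mult_left_mono order_refl) auto
  also have "\<dots> = B * ((1 - ?l / 2) * ?p) + K"
    by (simp add: algebra_simps)
  also have "\<dots> \<le> B * fw_step (Suc n) powr \<rho> + K"
    using B fw_step_powr_Suc_ge[OF \<rho>] by (intro add_right_mono mult_left_mono) auto
  finally show ?case .
qed

section \<open>Gradients within a set and convexity\<close>

lemma has_C1_gradient_on_subset:
  "has_C1_gradient_on g g' S \<Longrightarrow> T \<subseteq> S \<Longrightarrow> has_C1_gradient_on g g' T"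
  unfolding has_C1_gradient_on_def
  by (auto intro: has_derivative_subset continuous_on_subset)

lemma has_C1_gradient_on_continuous:
  "has_C1_gradient_on g g' S \<Longrightarrow> continuous_on S g"
  unfolding has_C1_gradient_on_def
  by (auto simp: continuous_on_eq_continuous_within intro: has_derivative_continuous)

text \<open>Derivatives exist only within \<open>S\<close>, so \<open>g\<close> is restricted to the
  segment from \<open>x\<close> to \<open>y\<close>. By convexity its difference quotients at
  \<open>x\<close> are at most \<open>g y - g x\<close>; their one-sided limit is the directional
  derivative.\<close>

lemma convex_on_gradient_inequality:
  fixes g :: "'a::real_inner \<Rightarrow> real"
  assumes cvx: "convex_on S g" and grad: "has_C1_gradient_on g g' S"
    and x: "x \<in> S" and y: "y \<in> S"
  shows "g x + (y - x) \<bullet> g' x \<le> g y"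
proof -
  define p where "p t = x + t *\<^sub>R (y - x)" for t :: real
  have p_conv: "p t = (1 - t) *\<^sub>R x + t *\<^sub>R y" for t
    by (simp add: p_def algebra_simps)
  have pS: "p ` {0..1} \<subseteq> S"
    using convex_on_imp_convex[OF cvx] x y by (auto simp: p_conv intro!: convexD)
  have dp: "(p has_derivative (\<lambda>t. t *\<^sub>R (y - x))) (at 0 within {0..1})"
    unfolding p_def by (auto intro!: derivative_eq_intros)
  have "(g has_derivative (\<lambda>h. h \<bullet> g' x)) (at (p 0) within p ` {0..1})"
  proof (rule has_derivative_subset[OF _ pS])
    show "(g has_derivative (\<lambda>h. h \<bullet> g' x)) (at (p 0) within S)"
      using grad x by (simp add: has_C1_gradient_on_def p_def)
  qed
  from diff_chain_within[OF dp this]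
  have "((g \<circ> p) has_field_derivative ((y - x) \<bullet> g' x)) (at 0 within {0..1})"
    by (simp add: has_field_derivative_def o_def mult_commute_abs)
  then have lim: "((\<lambda>t. (g (p t) - g x) / t) \<longlongrightarrow> (y - x) \<bullet> g' x) (at 0 within {0..1})"
    by (simp add: has_field_derivative_iff p_def)
  have "(g (p t) - g x) / t \<le> g y - g x" if "t \<in> {0..1}" "t \<noteq> 0" for t
  proof -
    have "g (p t) \<le> (1 - t) * g x + t * g y"
      unfolding p_conv using that x y by (intro convex_onD[OF cvx]) auto
    then show ?thesis
      using that by (simp add: field_simps)
  qed
  then have "eventually (\<lambda>t. (g (p t) - g x) / t \<le> g y - g x) (at 0 within {0..1})"
    by (auto simp: eventually_at_filter)
  moreover have "at (0::real) within {0..1} \<noteq> bot"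
    by (simp add: trivial_limit_within)
  ultimately have "(y - x) \<bullet> g' x \<le> g y - g x"
    using tendsto_upperbound[OF lim] by blast
  then show ?thesis
    by simp
qed

section \<open>Hausdorff distance and distance to a convex set\<close>

lemma hausdorff_dist_commute: "hausdorff_dist X Y = hausdorff_dist Y X"
  by (simp add: hausdorff_dist_def norm_minus_commute max.commute)

text \<open>A real \<open>SUP\<close> is known to be an upper bound only for families bounded above.
  Boundedness of \<open>X\<close> ensures this, because the distance to \<open>Y\<close> is at most
  the distance to one fixed point of \<open>Y\<close>.\<close>

lemma infdist_le_hausdorff_dist:
  fixes X Y :: "'a::real_normed_vector set"
  assumes "bounded X" "Y \<noteq> {}" "x \<in> X"
  shows "infdist x Y \<le> hausdorff_dist X Y"
proof -
  have eq: "(INF y\<in>Y. norm (x - y)) = infdist x Y" for x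
    using assms(2) by (simp add: infdist_def dist_norm)
  have "bounded ((\<lambda>x. infdist x Y) ` X)"
  proof -
    obtain y where y: "y \<in> Y"
      using assms(2) by blast
    obtain e where e: "\<And>x. x \<in> X \<Longrightarrow> dist x y \<le> e"
      using assms(1) by (metis bounded_any_center dist_commute)
    have "infdist x Y \<le> e" if "x \<in> X" for x
      using infdist_le[OF y, of x] e[OF that] by simp
    then show ?thesis
      by (auto simp: bounded_iff infdist_nonneg intro!: exI[of _ e])
  qed
  then have "infdist x Y \<le> (SUP x\<in>X. infdist x Y)"
    using assms(3) by (intro cSUP_upper bounded_imp_bdd_above)
  also have "\<dots> \<le> hausdorff_dist X Y"
    by (simp add: hausdorff_dist_def eq)
  finally show ?thesis .
qed

text \<open>The points of \<open>D\<close> nearest to \<open>x\<close> and \<open>s\<close>,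
  combined with the same weights, give a point of \<open>D\<close>; the triangle inequality does the
  rest. The left side has the shape of a Frank-Wolfe update.\<close>

lemma infdist_convex_combination_le:
  fixes D :: "'a::euclidean_space set"
  assumes "convex D" "closed D" "D \<noteq> {}" "0 \<le> l" "l \<le> 1"
  shows "infdist (x + l *\<^sub>R (s - x)) D \<le> (1 - l) * infdist x D + l * infdist s D"
proof -
  obtain p q where p: "p \<in> D" "infdist x D = dist x p" and q: "q \<in> D" "infdist s D = dist s q"
    using infdist_attains_inf[OF assms(2,3)] by metis
  have "(1 - l) *\<^sub>R p + l *\<^sub>R q \<in> D"
    using assms p q by (auto intro!: convexD)
  then have "infdist (x + l *\<^sub>R (s - x)) D \<le> dist (x + l *\<^sub>R (s - x)) ((1 - l) *\<^sub>R p + l *\<^sub>R q)"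
    by (rule infdist_le)
  also have "\<dots> = norm ((1 - l) *\<^sub>R (x - p) + l *\<^sub>R (s - q))"
    by (simp add: dist_norm algebra_simps)
  also have "\<dots> \<le> norm ((1 - l) *\<^sub>R (x - p)) + norm (l *\<^sub>R (s - q))"
    by (rule norm_triangle_ineq)
  also have "\<dots> = (1 - l) * infdist x D + l * infdist s D"
    using assms p q by (simp add: dist_norm)
  finally show ?thesis .
qed

section \<open>Gradient bounds, curvature and the linear subproblem\<close>

lemma norm_le_SUP:
  fixes g :: "'a::topological_space \<Rightarrow> 'b::real_normed_vector"
  assumes "compact E" "continuous_on E g" "x \<in> E"
  shows "norm (g x) \<le> (SUP x\<in>E. norm (g x))"
proof -
  have "compact ((\<lambda>x. norm (g x)) ` E)"
    using assms by (intro compact_continuous_image continuous_intros)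
  then show ?thesis
    using assms by (intro cSUP_upper bounded_imp_bdd_above compact_imp_bounded)
qed

lemma curvature_constant_finiteE:
  assumes "curvature_constant f f' E < \<infinity>"
  obtains C where "0 \<le> C" "\<And>x s l. x \<in> E \<Longrightarrow> s \<in> E \<Longrightarrow> 0 < l \<Longrightarrow> l \<le> 1 \<Longrightarrow>
    f (x + l *\<^sub>R (s - x)) \<le> f x + l * ((s - x) \<bullet> f' x) + l\<^sup>2 * (C / 2)"
proof -
  \<comment> \<open>The maximum with 0 makes the constant nonnegative and excludes the value of the
    supremum over an empty \<open>E\<close>, minus infinity.\<close>
  define c where "c = real_of_ereal (max 0 (curvature_constant f f' E))"
  have c: "ereal c = max 0 (curvature_constant f f' E)"
    unfolding c_def using assms by (intro ereal_real') (auto simp: max_def)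
  show ?thesis
  proof
    show "0 \<le> c"
      by (simp add: c_def real_of_ereal_pos)
    fix x s and l :: real
    assume x: "x \<in> E" "s \<in> E" and l: "0 < l" "l \<le> 1"
    have "ereal (2 / l\<^sup>2 * (f (x + l *\<^sub>R (s - x)) - f x - l * ((s - x) \<bullet> f' x)))
        \<le> curvature_constant f f' E"
      unfolding curvature_constant_def using x l
      by (intro SUP_upper2[of "(x, s, l)"]) auto
    also have "\<dots> \<le> ereal c"
      by (simp add: c)
    finally show "f (x + l *\<^sub>R (s - x)) \<le> f x + l * ((s - x) \<bullet> f' x) + l\<^sup>2 * (c / 2)"
      using l by (simp add: field_simps)
  qed
qed

text \<open>Let \<open>y\<close> be the point of \<open>Dn\<close> nearest to \<open>z\<close>, and
  decompose \<open>s - x\<close> along \<open>y\<close> and \<open>z\<close>. Minimality of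
  \<open>s\<close> disposes of the part paired with \<open>G\<close>, the gradient inequality treats
  \<open>z - x\<close>, and Cauchy-Schwarz bounds the domain error \<open>y - z\<close> and the
  gradient error. The latter is paired only with \<open>s - y\<close>, so the diameter enters
  once.\<close>

lemma inexact_linear_minimizer_gap:
  fixes f :: "'a::euclidean_space \<Rightarrow> real"
  assumes cvx: "convex_on E f" and grad: "has_C1_gradient_on f f' E" and E: "bounded E"
    and Dn: "compact Dn" "Dn \<subseteq> E"
    and x: "x \<in> E" and z: "z \<in> E"
    and s: "s \<in> Dn" "\<And>y. y \<in> Dn \<Longrightarrow> s \<bullet> G \<le> y \<bullet> G"
    and L: "norm (f' x) \<le> L" and h: "infdist z Dn \<le> h" and d: "norm (G - f' x) \<le> d"
  shows "(s - x) \<bullet> f' x \<le> f z - f x + h * L + d * diameter E"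
proof -
  obtain y where y: "y \<in> Dn" "infdist z Dn = dist z y"
    using infdist_attains_inf[of Dn z] compact_imp_closed[OF Dn(1)] s(1) by blast
  have "(s - y) \<bullet> G \<le> 0"
    using s(2)[OF y(1)] by (simp add: inner_diff_left)
  moreover have "(z - x) \<bullet> f' x \<le> f z - f x"
    using convex_on_gradient_inequality[OF cvx grad x z] by simp
  moreover have "(y - z) \<bullet> f' x \<le> h * L"
  proof -
    have "(y - z) \<bullet> f' x \<le> norm (y - z) * norm (f' x)"
      by (rule norm_cauchy_schwarz)
    also have "\<dots> \<le> h * L"
      using y h L order_trans[OF infdist_nonneg h]
      by (intro mult_mono) (auto simp: dist_norm norm_minus_commute)
    finally show ?thesis .
  qed
  moreover have "(s - y) \<bullet> (f' x - G) \<le> d * diameter E"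
  proof -
    have "(s - y) \<bullet> (f' x - G) \<le> norm (f' x - G) * norm (s - y)"
      by (metis norm_cauchy_schwarz mult.commute)
    also have "\<dots> \<le> d * diameter E"
    proof (rule mult_mono)
      show "norm (s - y) \<le> diameter E"
        using diameter_bounded_bound[OF E, of s y] s(1) y(1) Dn(2) by (auto simp: dist_norm)
    qed (use d order_trans[OF norm_ge_zero d] in \<open>auto simp: norm_minus_commute\<close>)
    finally show ?thesis .
  qed
  moreover have "(s - x) \<bullet> f' x
      = (s - y) \<bullet> (f' x - G) + (s - y) \<bullet> G + (y - z) \<bullet> f' x + (z - x) \<bullet> f' x"
    by (simp add: inner_diff_left inner_diff_right)
  ultimately show ?thesis
    by linarith
qed

section \<open>The iterate process\<close>

lemma frank_wolfe_process_measurable: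
  assumes "frank_wolfe_process M E D F' S X"
  shows "X n \<in> borel_measurable M"
proof (induction n)
  case 0
  show ?case
    using assms by (simp add: frank_wolfe_process_def)
next
  case (Suc n)
  have "S (Suc n) \<in> borel_measurable M"
    using assms by (simp add: frank_wolfe_process_def)
  with Suc have "(\<lambda>\<omega>. X n \<omega> + fw_step n *\<^sub>R (S (Suc n) \<omega> - X n \<omega>)) \<in> borel_measurable M"
    by measurable
  moreover have "X (Suc n) \<omega> = X n \<omega> + fw_step n *\<^sub>R (S (Suc n) \<omega> - X n \<omega>)"
    if "\<omega> \<in> space M" for \<omega>
    using assms that by (simp add: frank_wolfe_process_def)
  ultimately show ?case
    by (simp cong: measurable_cong)
qed

text \<open>On the good event the indicator is 1, so the selection is a genuine minimiser of the
  linear objective.\<close>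

lemma frank_wolfe_process_good_event:
  assumes "frank_wolfe_process M E D F' S X" "\<omega> \<in> fw_good_event M E D (X 0)"
  shows "X (Suc n) \<omega> = X n \<omega> + fw_step n *\<^sub>R (S (Suc n) \<omega> - X n \<omega>)"
    and "S (Suc n) \<omega> \<in> D (Suc n) \<omega>"
    and "y \<in> D (Suc n) \<omega> \<Longrightarrow> S (Suc n) \<omega> \<bullet> F' (Suc n) \<omega> (X n \<omega>) \<le> y \<bullet> F' (Suc n) \<omega> (X n \<omega>)"
    and "D (Suc n) \<omega> \<subseteq> E"
proof -
  have \<omega>: "\<omega> \<in> space M" and sub: "(\<Union>n\<in>{1..}. D n \<omega>) \<subseteq> E"
    using assms(2) by (auto simp: fw_good_event_def)
  show "X (Suc n) \<omega> = X n \<omega> + fw_step n *\<^sub>R (S (Suc n) \<omega> - X n \<omega>)"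
    using assms(1) \<omega> by (simp add: frank_wolfe_process_def)
  have fw: "is_arg_min
      (\<lambda>s. indicator (fw_good_event M E D (X 0)) \<omega> * (s \<bullet> F' (Suc n) \<omega> (X n \<omega>)))
      (\<lambda>s. s \<in> D (Suc n) \<omega>) (S (Suc n) \<omega>)"
    using assms(1) \<omega> by (simp add: frank_wolfe_process_def)
  have min: "is_arg_min (\<lambda>s. s \<bullet> F' (Suc n) \<omega> (X n \<omega>)) (\<lambda>s. s \<in> D (Suc n) \<omega>) (S (Suc n) \<omega>)"
    using fw assms(2) \<omega> by simp
  then show "S (Suc n) \<omega> \<in> D (Suc n) \<omega>"
    by (simp add: is_arg_min_def)
  show "S (Suc n) \<omega> \<bullet> F' (Suc n) \<omega> (X n \<omega>) \<le> y \<bullet> F' (Suc n) \<omega> (X n \<omega>)"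
    if "y \<in> D (Suc n) \<omega>"
    using min that by (simp add: is_arg_min_linorder)
  show "D (Suc n) \<omega> \<subseteq> E"
    using sub by (simp add: UN_subset_iff)
qed

text \<open>Every update is a convex combination of the previous iterate and a point of
  \<open>E\<close>, as step sizes lie between 0 and 1.\<close>

lemma frank_wolfe_process_in_domain:
  assumes "frank_wolfe_process M E D F' S X" "\<omega> \<in> fw_good_event M E D (X 0)" "convex E"
  shows "X n \<omega> \<in> E"
proof (induction n)
  case 0
  show ?case
    using assms(2) by (simp add: fw_good_event_def)
next
  case (Suc n)
  have "S (Suc n) \<omega> \<in> E"
    using frank_wolfe_process_good_event(2,4)[OF assms(1,2)] by blast
  then have "(1 - fw_step n) *\<^sub>R X n \<omega> + fw_step n *\<^sub>R S (Suc n) \<omega> \<in> E"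
    using Suc assms(3) by (intro convexD) auto
  then show ?case
    by (simp add: frank_wolfe_process_good_event(1)[OF assms(1,2)] algebra_simps)
qed

text \<open>Bonferroni's inequality for two events, applied twice.\<close>

lemma (in prob_space) prob_inter3_ge:
  assumes "U \<in> events" "V \<in> events" "W \<in> events"
    and "prob U \<ge> 1 - u" "prob V \<ge> 1 - v" "prob W \<ge> 1 - w"
  shows "prob (U \<inter> V \<inter> W) \<ge> 1 - (u + v + w)"
proof -
  have *: "prob A + prob B - 1 \<le> prob (A \<inter> B)" if "A \<in> events" "B \<in> events" for A B
  proof -
    have "prob (A \<union> B) = prob A + prob (B - A)"
      using that by (rule finite_measure_Union')
    moreover have "prob (B - A) = prob B - prob (B \<inter> A)"
      using that by (intro finite_measure_Diff')
    moreover have "prob (A \<union> B) \<le> 1"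
      by (rule prob_le_1)
    ultimately show ?thesis
      by (simp add: Int_commute)
  qed
  have "prob (U \<inter> V) + prob W - 1 \<le> prob (U \<inter> V \<inter> W)"
    using assms by (intro * sets.Int)
  moreover have "prob U + prob V - 1 \<le> prob (U \<inter> V)"
    using assms by (intro *)
  ultimately show ?thesis
    using assms(4-6) by linarith
qed

theorem theorem2:
  fixes M :: "'w measure"
    and f :: "'a::euclidean_space \<Rightarrow> real" and f' :: "'a \<Rightarrow> 'a"
    and dom_f D0 E :: "'a set"
    and D :: "nat \<Rightarrow> 'w \<Rightarrow> 'a set"
    and F :: "nat \<Rightarrow> 'w \<Rightarrow> 'a \<Rightarrow> real" and F' :: "nat \<Rightarrow> 'w \<Rightarrow> 'a \<Rightarrow> 'a"
    and S X :: "nat \<Rightarrow> 'w \<Rightarrow> 'a"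
    and \<epsilon> \<beta>\<^sub>1 \<beta>\<^sub>2 r\<^sub>1 r\<^sub>2 \<eta>\<^sub>1 \<eta>\<^sub>2 c\<^sub>1 c\<^sub>2 :: real
  defines "Pstar \<equiv> (INF x\<in>D0. f x)"
    and "\<Delta> \<equiv> diameter E"
    and "L \<equiv> (SUP x\<in>E. norm (f' x))"
    and "r \<equiv> min r\<^sub>1 r\<^sub>2"
  assumes "prob_space M" and "complete_measure M"
    and "closed dom_f" and "convex_on dom_f f" and "has_C1_gradient_on f f' dom_f"
    and "D0 \<in> compact_convex_sets" and "D0 \<subseteq> dom_f"
    and "\<And>n. n \<ge> 1 \<Longrightarrow> D n \<in> measurable M hausdorff_borel"
    and "\<And>n. n \<ge> 1 \<Longrightarrow> (\<lambda>\<omega>. (F n \<omega>, F' n \<omega>)) \<in> measurable M (C1_borel E)"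
    and "frank_wolfe_process M E D F' S X"
    and "\<epsilon> \<in> {0..1}" and "\<beta>\<^sub>1 \<in> {0..1}" and "\<beta>\<^sub>2 \<in> {0..1}"
    and "r\<^sub>1 \<in> {0<..1}" and "r\<^sub>2 \<in> {0<..1}"
    and "\<eta>\<^sub>1 \<ge> 0" and "\<eta>\<^sub>2 \<ge> 0" and "c\<^sub>1 > 0" and "c\<^sub>2 > 0"
    and "E \<in> compact_convex_sets" and "D0 \<subseteq> E" and "E \<subseteq> dom_f"
    and "\<P>(\<omega> in M. (\<Union>n\<in>{1..}. D n \<omega>) \<subseteq> E) \<ge> 1 - \<epsilon>"
    and "\<P>(\<omega> in M. \<forall>n\<ge>1. hausdorff_dist (D (Suc n) \<omega>) D0 \<le> c\<^sub>1 * fw_step n powr r\<^sub>1 + \<eta>\<^sub>1)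
           \<ge> 1 - \<beta>\<^sub>1"
    and "\<P>(\<omega> in M. \<forall>n\<ge>1. (SUP x\<in>E. norm (F' (Suc n) \<omega> x - f' x)) \<le> c\<^sub>2 * fw_step n powr r\<^sub>2 + \<eta>\<^sub>2)
           \<ge> 1 - \<beta>\<^sub>2"
    and "curvature_constant f f' E < \<infinity>"
  shows "\<exists>A\<ge>0. \<exists>B\<ge>0.
           \<P>(\<omega> in M. \<forall>n\<ge>1. X n \<omega> \<in> dom_f \<and>
                - A * fw_step n powr r\<^sub>1 - \<eta>\<^sub>1 * L \<le> f (X n \<omega>) - Pstar \<and>
                f (X n \<omega>) - Pstar \<le> B * fw_step n powr r + \<eta>\<^sub>1 * L + 2 * \<eta>\<^sub>2 * \<Delta>)
             \<ge> 1 - (\<beta>\<^sub>1 + \<beta>\<^sub>2 + \<epsilon>)"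
proof -

  \<comment> \<open>Extremal values of the objective and its gradient\<close>
  interpret prob_space M by fact
  note fw = \<open>frank_wolfe_process M E D F' S X\<close>
  have E: "compact E" "convex E" "E \<noteq> {}" and D0: "compact D0" "convex D0" "D0 \<noteq> {}"
    using \<open>E \<in> compact_convex_sets\<close> \<open>D0 \<in> compact_convex_sets\<close>
    by (auto simp: compact_convex_sets_def)
  have gradE: "has_C1_gradient_on f f' E"
    using \<open>has_C1_gradient_on f f' dom_f\<close> \<open>E \<subseteq> dom_f\<close> by (rule has_C1_gradient_on_subset)
  have cvxE: "convex_on E f"
    using \<open>convex_on dom_f f\<close> \<open>E \<subseteq> dom_f\<close> E(2) by (rule convex_on_subset)
  have contf': "continuous_on E f'"
    using gradE by (simp add: has_C1_gradient_on_def)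
  have contf: "continuous_on dom_f f"
    using \<open>has_C1_gradient_on f f' dom_f\<close> by (rule has_C1_gradient_on_continuous)
  have L: "norm (f' x) \<le> L" if "x \<in> E" for x
    unfolding L_def using E(1) contf' that by (rule norm_le_SUP)
  have L0: "0 \<le> L"
    using L E(3) by (meson all_not_in_conv norm_ge_zero order_trans)
  have \<Delta>0: "0 \<le> \<Delta>"
    unfolding \<Delta>_def using E(1) by (intro diameter_ge_0 compact_imp_bounded)
  obtain z where z: "z \<in> D0" "\<And>x. x \<in> D0 \<Longrightarrow> f z \<le> f x"
    using continuous_attains_inf[OF D0(1,3) continuous_on_subset[OF contf \<open>D0 \<subseteq> dom_f\<close>]] by blast
  have Pstar: "Pstar = f z"
    unfolding Pstar_def using z by (intro cInf_eq_minimum) auto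
  have zE: "z \<in> E"
    using z \<open>D0 \<subseteq> E\<close> by blast
  \<comment> \<open>The maximum of \<open>f\<close> over \<open>E\<close> bounds the initial error,
    at an iterate known only to lie in \<open>E\<close>.\<close>
  obtain m where m: "m \<in> E" "\<And>x. x \<in> E \<Longrightarrow> f x \<le> f m"
    using continuous_attains_sup[OF E(1,3) continuous_on_subset[OF contf \<open>E \<subseteq> dom_f\<close>]] by blast
  obtain C where C: "0 \<le> C" "\<And>x s l. x \<in> E \<Longrightarrow> s \<in> E \<Longrightarrow> 0 < l \<Longrightarrow> l \<le> 1 \<Longrightarrow>
      f (x + l *\<^sub>R (s - x)) \<le> f x + l * ((s - x) \<bullet> f' x) + l\<^sup>2 * (C / 2)"
    using curvature_constant_finiteE[OF \<open>curvature_constant f f' E < \<infinity>\<close>] by metis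
  have r: "r \<in> {0<..1}"
    using \<open>r\<^sub>1 \<in> {0<..1}\<close> \<open>r\<^sub>2 \<in> {0<..1}\<close> by (auto simp: r_def)

  \<comment> \<open>Constants and events\<close>
  define Q where "Q = c\<^sub>1 * L + c\<^sub>2 * \<Delta> + C / 2"
  \<comment> \<open>\<open>Q\<close> collects the coefficients of the rate in one step: domain
    error, gradient error and curvature. In \<open>B\<close> and \<open>A'\<close> the first entry
    of the maximum gives \<open>2 * Q \<le> B\<close> and \<open>2 * c\<^sub>1 \<le> A'\<close>; the
    factor 3/2 in the second cancels the initial 2/3 of the recursion.\<close>
  define B where "B = max (2 * Q) (3 / 2 * (f m - f z))"
  define A' where "A' = max (2 * c\<^sub>1) (3 / 2 * \<Delta>)"
  define A where "A = A' * L"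
  have Q0: "0 \<le> Q"
    using L0 \<Delta>0 C(1) \<open>c\<^sub>1 > 0\<close> \<open>c\<^sub>2 > 0\<close> by (simp add: Q_def)
  then have B0: "0 \<le> B"
    by (simp add: B_def le_max_iff_disj)
  have A'0: "0 \<le> A'"
    using \<open>c\<^sub>1 > 0\<close> by (simp add: A'_def le_max_iff_disj)
  then have A0: "0 \<le> A"
    using L0 by (simp add: A_def)

  define U where "U = {\<omega> \<in> space M. (\<Union>n\<in>{1..}. D n \<omega>) \<subseteq> E}"
  define V where
    "V = {\<omega> \<in> space M. \<forall>n\<ge>1. hausdorff_dist (D (Suc n) \<omega>) D0 \<le> c\<^sub>1 * fw_step n powr r\<^sub>1 + \<eta>\<^sub>1}"
  define W where
    "W = {\<omega> \<in> space M. \<forall>n\<ge>1. (SUP x\<in>E. norm (F' (Suc n) \<omega> x - f' x)) \<le> c\<^sub>2 * fw_step n powr r\<^sub>2 + \<eta>\<^sub>2}"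
  define R where "R = {\<omega> \<in> space M. \<forall>n\<ge>1. X n \<omega> \<in> dom_f \<and>
                - A * fw_step n powr r\<^sub>1 - \<eta>\<^sub>1 * L \<le> f (X n \<omega>) - Pstar \<and>
                f (X n \<omega>) - Pstar \<le> B * fw_step n powr r + \<eta>\<^sub>1 * L + 2 * \<eta>\<^sub>2 * \<Delta>}"

  \<comment> \<open>Bounds along a fixed path\<close>
  have bounds: "\<omega> \<in> R" if \<omega>: "\<omega> \<in> U" "\<omega> \<in> V" "\<omega> \<in> W" and X0: "X 0 \<omega> \<in> E" for \<omega>
  proof -
    have sp: "\<omega> \<in> space M"
      using \<omega> by (simp add: U_def)
    have good: "\<omega> \<in> fw_good_event M E D (X 0)"
      using \<omega>(1) X0 by (simp add: U_def fw_good_event_def)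
    note step = frank_wolfe_process_good_event[OF fw good]
    have XE: "X n \<omega> \<in> E" for n
      using fw good E(2) by (rule frank_wolfe_process_in_domain)
    have SE: "S (Suc n) \<omega> \<in> E" for n
      using step(2,4) by blast
    \<comment> \<open>A measurable map takes its values in the space of its target, here the
      nonempty compact convex sets.\<close>
    have Dn: "compact (D (Suc n) \<omega>)" "D (Suc n) \<omega> \<noteq> {}" for n
      using measurable_space[OF assms(12)[of "Suc n"] sp] by (auto simp: compact_convex_sets_def)
    have haus: "hausdorff_dist (D (Suc n) \<omega>) D0 \<le> c\<^sub>1 * fw_step n powr r\<^sub>1 + \<eta>\<^sub>1" if "n \<ge> 1" for n
      using \<omega>(2) that by (simp add: V_def)

    \<comment> \<open>The recursion is applied with \<open>c\<^sub>1\<close> for \<open>Q\<close>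
      and \<open>\<eta>\<^sub>1\<close> for \<open>K\<close>.\<close>
    have dist_bound: "infdist (X n \<omega>) D0 \<le> A' * fw_step n powr r\<^sub>1 + \<eta>\<^sub>1" if "n \<ge> 1" for n
    proof (rule fw_step_recursion_bound[OF \<open>r\<^sub>1 \<in> {0<..1}\<close> A'0 _ _ _ that])
      show "2 * c\<^sub>1 \<le> A'"
        by (simp add: A'_def)
      have "infdist (X 1 \<omega>) D0 \<le> dist (X 1 \<omega>) z"
        using z(1) by (rule infdist_le)
      also have "\<dots> \<le> \<Delta>"
        unfolding \<Delta>_def using E(1) XE zE by (intro diameter_bounded_bound compact_imp_bounded)
      also have "\<dots> \<le> 2 / 3 * A' + \<eta>\<^sub>1"
        using \<open>\<eta>\<^sub>1 \<ge> 0\<close> by (simp add: A'_def max_def)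
      finally show "infdist (X 1 \<omega>) D0 \<le> 2 / 3 * A' + \<eta>\<^sub>1" .
      fix n :: nat assume n: "n \<ge> 1"
      have "infdist (S (Suc n) \<omega>) D0 \<le> hausdorff_dist (D (Suc n) \<omega>) D0"
        using Dn step(2) D0(3) by (intro infdist_le_hausdorff_dist compact_imp_bounded)
      also note haus[OF n]
      finally have "fw_step n * infdist (S (Suc n) \<omega>) D0
          \<le> fw_step n * (c\<^sub>1 * fw_step n powr r\<^sub>1 + \<eta>\<^sub>1)"
        by (intro mult_left_mono) auto
      moreover have "infdist (X (Suc n) \<omega>) D0
          \<le> (1 - fw_step n) * infdist (X n \<omega>) D0 + fw_step n * infdist (S (Suc n) \<omega>) D0"
        unfolding step(1) using D0 by (intro infdist_convex_combination_le compact_imp_closed) auto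
      ultimately show "infdist (X (Suc n) \<omega>) D0 \<le> (1 - fw_step n) * infdist (X n \<omega>) D0
          + fw_step n * (c\<^sub>1 * fw_step n powr r\<^sub>1 + \<eta>\<^sub>1)"
        by linarith
    qed

    have lower: "- A * fw_step n powr r\<^sub>1 - \<eta>\<^sub>1 * L \<le> f (X n \<omega>) - Pstar" if n: "n \<ge> 1" for n
    proof -
      \<comment> \<open>The gradient inequality is used at the projection \<open>p\<close>, not at
        the iterate, because \<open>f p\<close> is at least \<open>Pstar\<close>. Cauchy-Schwarz
        then turns the distance bound into a bound on values.\<close>
      obtain p where p: "p \<in> D0" "infdist (X n \<omega>) D0 = dist (X n \<omega>) p"
        using infdist_attains_inf[OF compact_imp_closed[OF D0(1)] D0(3)] by blast
      have pE: "p \<in> E"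
        using p \<open>D0 \<subseteq> E\<close> by blast
      have "- ((X n \<omega> - p) \<bullet> f' p) \<le> norm (X n \<omega> - p) * norm (f' p)"
        using Cauchy_Schwarz_ineq2[of "X n \<omega> - p" "f' p"] by linarith
      also have "\<dots> \<le> (A' * fw_step n powr r\<^sub>1 + \<eta>\<^sub>1) * L"
        using dist_bound[OF n] p L[OF pE] A'0 \<open>\<eta>\<^sub>1 \<ge> 0\<close> by (intro mult_mono) (auto simp: dist_norm)
      finally have "- ((X n \<omega> - p) \<bullet> f' p) \<le> A * fw_step n powr r\<^sub>1 + \<eta>\<^sub>1 * L"
        by (simp add: A_def algebra_simps)
      moreover have "f p + (X n \<omega> - p) \<bullet> f' p \<le> f (X n \<omega>)"
        using cvxE gradE pE XE by (rule convex_on_gradient_inequality)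
      moreover have "Pstar \<le> f p"
        using z(2)[OF p(1)] by (simp add: Pstar)
      ultimately show ?thesis
        by simp
    qed

    have upper: "f (X n \<omega>) - Pstar \<le> B * fw_step n powr r + (\<eta>\<^sub>1 * L + \<eta>\<^sub>2 * \<Delta>)"
      if "n \<ge> 1" for n
    proof (rule fw_step_recursion_bound[OF r B0 _ _ _ that])
      show "2 * Q \<le> B"
        by (simp add: B_def)
      have "f (X 1 \<omega>) - Pstar \<le> 2 / 3 * B"
        using m(2)[OF XE, of 1] by (simp add: B_def Pstar max_def)
      moreover have "0 \<le> \<eta>\<^sub>1 * L + \<eta>\<^sub>2 * \<Delta>"
        using \<open>\<eta>\<^sub>1 \<ge> 0\<close> \<open>\<eta>\<^sub>2 \<ge> 0\<close> L0 \<Delta>0 by simp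
      ultimately show "f (X 1 \<omega>) - Pstar \<le> 2 / 3 * B + (\<eta>\<^sub>1 * L + \<eta>\<^sub>2 * \<Delta>)"
        by simp
      fix n :: nat assume n: "n \<ge> 1"
      let ?l = "fw_step n" and ?G = "F' (Suc n) \<omega>"
      let ?gap = "(S (Suc n) \<omega> - X n \<omega>) \<bullet> f' (X n \<omega>)"
      \<comment> \<open>Continuity on the compact \<open>E\<close> makes the uniform gradient error
        a true bound at the random point \<open>X n \<omega>\<close>.\<close>
      have "continuous_on E ?G"
        using measurable_space[OF assms(13)[of "Suc n"] sp]
        by (auto simp: convex_C1_def has_C1_gradient_on_def)
      then have "norm (?G (X n \<omega>) - f' (X n \<omega>)) \<le> (SUP x\<in>E. norm (?G x - f' x))"
        using E(1) XE contf' by (intro norm_le_SUP[where g = "\<lambda>x. ?G x - f' x"] continuous_intros)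
      also have "\<dots> \<le> c\<^sub>2 * ?l powr r\<^sub>2 + \<eta>\<^sub>2"
        using \<omega>(3) n by (simp add: W_def)
      finally have grad_err: "norm (?G (X n \<omega>) - f' (X n \<omega>)) \<le> c\<^sub>2 * ?l powr r\<^sub>2 + \<eta>\<^sub>2" .
      \<comment> \<open>This uses the other half of the Hausdorff distance: the lower bound needs
        selections close to \<open>D0\<close>, the upper bound needs \<open>z\<close> close to the
        current domain.\<close>
      have "infdist z (D (Suc n) \<omega>) \<le> hausdorff_dist D0 (D (Suc n) \<omega>)"
        using z(1) Dn D0(1) by (intro infdist_le_hausdorff_dist compact_imp_bounded)
      also have "\<dots> \<le> c\<^sub>1 * ?l powr r\<^sub>1 + \<eta>\<^sub>1"
        using haus[OF n] by (simp add: hausdorff_dist_commute)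
      finally have dom_err: "infdist z (D (Suc n) \<omega>) \<le> c\<^sub>1 * ?l powr r\<^sub>1 + \<eta>\<^sub>1" .
      \<comment> \<open>For a base in (0,1] a smaller exponent gives a larger power, so all rates
        reduce to \<open>r\<close>. The last inequality serves the curvature term, which is
        quadratic in the step size.\<close>
      have powr_le: "?l powr r\<^sub>1 \<le> ?l powr r" "?l powr r\<^sub>2 \<le> ?l powr r" "?l \<le> ?l powr r"
        using powr_mono'[of r 1 ?l] r by (auto simp: r_def intro!: powr_mono')
      have "?gap \<le> f z - f (X n \<omega>) + (c\<^sub>1 * ?l powr r\<^sub>1 + \<eta>\<^sub>1) * L + (c\<^sub>2 * ?l powr r\<^sub>2 + \<eta>\<^sub>2) * \<Delta>"
        unfolding \<Delta>_def
        using cvxE gradE compact_imp_bounded[OF E(1)] Dn(1) step(4) XE zE step(2,3) L[OF XE]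
          dom_err grad_err
        by (rule inexact_linear_minimizer_gap)
      also have "\<dots> \<le> f z - f (X n \<omega>) + (c\<^sub>1 * ?l powr r + \<eta>\<^sub>1) * L + (c\<^sub>2 * ?l powr r + \<eta>\<^sub>2) * \<Delta>"
        using powr_le L0 \<Delta>0 \<open>c\<^sub>1 > 0\<close> \<open>c\<^sub>2 > 0\<close>
        by (intro add_mono mult_right_mono mult_left_mono order_refl) auto
      finally have gap: "?l * ?gap \<le> ?l * (f z - f (X n \<omega>) + (c\<^sub>1 * ?l powr r + \<eta>\<^sub>1) * L
          + (c\<^sub>2 * ?l powr r + \<eta>\<^sub>2) * \<Delta>)"
        by (intro mult_left_mono) auto
      have curv: "?l\<^sup>2 * (C / 2) \<le> ?l * (C / 2 * ?l powr r)"
        using mult_left_mono[OF powr_le(3), of "?l * (C / 2)"] C(1)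
        by (simp add: power2_eq_square mult_ac)
      have "f (X (Suc n) \<omega>) \<le> f (X n \<omega>) + ?l * ?gap + ?l\<^sup>2 * (C / 2)"
        unfolding step(1) using XE SE by (intro C(2)) auto
      also have "\<dots> \<le> f (X n \<omega>) + ?l * (f z - f (X n \<omega>) + (c\<^sub>1 * ?l powr r + \<eta>\<^sub>1) * L
          + (c\<^sub>2 * ?l powr r + \<eta>\<^sub>2) * \<Delta>) + ?l * (C / 2 * ?l powr r)"
        using gap curv by linarith
      finally show "f (X (Suc n) \<omega>) - Pstar \<le> (1 - ?l) * (f (X n \<omega>) - Pstar)
          + ?l * (Q * ?l powr r + (\<eta>\<^sub>1 * L + \<eta>\<^sub>2 * \<Delta>))"
        by (simp add: Pstar Q_def algebra_simps)
    qed

    \<comment> \<open>The recursion yields \<open>\<eta>\<^sub>2 * \<Delta>\<close> once; doubling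
      it weakens the bound, since it is nonnegative.\<close>
    have "f (X n \<omega>) - Pstar \<le> B * fw_step n powr r + \<eta>\<^sub>1 * L + 2 * \<eta>\<^sub>2 * \<Delta>" if "n \<ge> 1" for n
      using upper[OF that] mult_nonneg_nonneg[OF \<open>\<eta>\<^sub>2 \<ge> 0\<close> \<Delta>0] by linarith
    with lower XE \<open>E \<subseteq> dom_f\<close> sp show ?thesis
      by (auto simp: R_def)
  qed

  \<comment> \<open>Measurability of the final event\<close>
  have R: "R \<in> events"
  proof -
    \<comment> \<open>Off \<open>dom_f\<close> the total function \<open>f\<close> is arbitrary.
      With membership in \<open>dom_f\<close> included, the condition at each n describes the
      preimage of a closed set, as \<open>f\<close> is continuous on the closed set
      \<open>dom_f\<close>.\<close>
    have "closed {x \<in> dom_f. a \<le> f x - Pstar \<and> f x - Pstar \<le> b}" for a b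
    proof -
      have "closed (dom_f \<inter> f -` {a + Pstar..b + Pstar})"
        using contf \<open>closed dom_f\<close> by (intro continuous_closed_preimage) auto
      also have "dom_f \<inter> f -` {a + Pstar..b + Pstar} = {x \<in> dom_f. a \<le> f x - Pstar \<and> f x - Pstar \<le> b}"
        by auto
      finally show ?thesis .
    qed
    then have "X n -` {x \<in> dom_f. a \<le> f x - Pstar \<and> f x - Pstar \<le> b} \<inter> space M \<in> events" for n a b
      by (intro measurable_sets[OF frank_wolfe_process_measurable[OF fw]] borel_closed)
    moreover have "X n -` {x \<in> dom_f. a \<le> f x - Pstar \<and> f x - Pstar \<le> b} \<inter> space M
        = {\<omega> \<in> space M. X n \<omega> \<in> dom_f \<and> a \<le> f (X n \<omega>) - Pstar \<and> f (X n \<omega>) - Pstar \<le> b}"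
      for n a b
      by auto
    ultimately have "{\<omega> \<in> space M. X n \<omega> \<in> dom_f \<and> a \<le> f (X n \<omega>) - Pstar \<and> f (X n \<omega>) - Pstar \<le> b}
        \<in> events" for n a b
      by metis
    then show ?thesis
      unfolding R_def by (intro sets.sets_Collect_countable_All sets.sets_Collect_imp sets.sets_Collect_const)
  qed

  \<comment> \<open>From paths to probabilities\<close>
  have probs: "prob V \<ge> 1 - \<beta>\<^sub>1" "prob W \<ge> 1 - \<beta>\<^sub>2" "prob U \<ge> 1 - \<epsilon>"
    unfolding U_def V_def W_def by fact+
  \<comment> \<open>Nothing guarantees that \<open>U\<close>, \<open>V\<close>, \<open>W\<close> are events; one that is not has measure \<open>0\<close>,
    and then the claim is void.\<close>
  have "prob R \<ge> 1 - (\<beta>\<^sub>1 + \<beta>\<^sub>2 + \<epsilon>)"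
  proof (cases "U \<in> events \<and> V \<in> events \<and> W \<in> events")
    case True
    have "prob (V \<inter> W \<inter> U) \<ge> 1 - (\<beta>\<^sub>1 + \<beta>\<^sub>2 + \<epsilon>)"
      using True probs by (intro prob_inter3_ge) blast+
    also have "prob (V \<inter> W \<inter> U) \<le> prob R"
    \<comment> \<open>The inclusion holds only up to a null set, because the start lies in
      \<open>E\<close> only almost surely.\<close>
    proof (rule finite_measure_mono_AE[OF _ R])
      have "AE \<omega> in M. X 0 \<omega> \<in> E"
        using fw by (simp add: frank_wolfe_process_def)
      then show "AE \<omega> in M. \<omega> \<in> V \<inter> W \<inter> U \<longrightarrow> \<omega> \<in> R"
        by eventually_elim (use bounds in blast)
    qed
    finally show ?thesis .
  next
    case False
    then have "prob U = 0 \<or> prob V = 0 \<or> prob W = 0"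
      by (auto simp: measure_notin_sets)
    then have "1 - (\<beta>\<^sub>1 + \<beta>\<^sub>2 + \<epsilon>) \<le> 0"
      using probs \<open>\<epsilon> \<in> {0..1}\<close> \<open>\<beta>\<^sub>1 \<in> {0..1}\<close> \<open>\<beta>\<^sub>2 \<in> {0..1}\<close> by auto
    then show ?thesis
      by (rule order_trans[OF _ measure_nonneg])
  qed
  with A0 B0 show ?thesis
    unfolding R_def by (intro exI[of _ A] exI[of _ B] conjI)
qed

end
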